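(* Let $n\ge1$ and $r\ge 0$ be integers and let $x,x',y,y'\in H_n$. Write $G_r(u)=(P(u),Q(u))$ for the left and right tableaux of $u\in H_n$ under the domino Robinson-Schensted map $G_r$. Suppose that $P(x)=P(y)$, $P(x')=P(y')$, $Q(x)=Q(x')$ and $Q(y)=Q(y')$. Then $$\mu(x,y)=\mu(x',y'),$$ where $\mu(v,w)=(-1)^{\ell(v)+\ell(w)}$.
   Context: **Signed permutations.** $H_n$ is the hyperoctahedral group (Weyl group of type $B_n$) of signed permutations, i.e. bijections $w$ of $\{\pm1,\dots,\pm n\}$ with $w(-k)=-w(k)$, written in one-line notation $w=w_1w_2\ldots w_n$ with $w_k=w(k)$. It is generated by $t$ (one-line notation $\overline{1}\,2\ldots n$, where a bar denotes a negative sign) and $s_i$ for $1\le i<n$ (the transposition exchanging $i$ and $i+1$). Let $\ell$ be the length function with respect to these generators. The function $\mu(v,w)=(-1)^{\ell(v)+\ell(w)}$ is the form taken by the Möbius function of the Bruhat order. **Domino tableaux.** Partitions are identified with Young diagrams; square $(i,j)$ is in row $i$ and column $j$, with rows and columns numbered from $1$ starting at the top left. A domino is a pair of squares sharing a side. Let $\delta_r=(r,r-1,\dots,1)$. A standard domino tableau of rank $r$ with $n$ dominos is a chain of partitions $\delta_r=\lambda^0\subset\lambda^1\subset\cdots\subset\lambda^n$ such that each $\lambda^k/\lambda^{k-1}$ is a domino (whose squares are labeled $k$). The shape is $\lambda^n$. The set of these tableaux is $SDT_r(n)$. **The map $G_r$.** The domino Robinson-Schensted map $G_r$ is a bijection from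 $H_n$ onto the set of same-shape pairs in $SDT_r(n)\times SDT_r(n)$. It is given by domino insertion into $\delta_r$ (positive letters are inserted as horizontal dominos in the first row, negative ones as vertical dominos in the first column); $P$ is the insertion (left) tableau and $Q$ the recording (right) tableau. Equivalently, in growth diagram form: define partitions $\lambda(i,j)$, $0\le i,j\le n$, by $\lambda(i,0)=\lambda(0,j)=\delta_r$ and the following rules, in which $\lambda=\lambda(i-1,j-1)$, $\mu=\lambda(i-1,j)$, $\nu=\lambda(i,j-1)$, $\rho=\lambda(i,j)$ (here $\mu$ denotes a partition): 1. If $w_i=j$, then $\lambda=\mu=\nu$, and $\rho$ is $\lambda$ with two squares added to the first row. If $w_i=-j$, then $\lambda=\mu=\nu$, and $\rho$ is $\lambda$ with two squares added to the first column. 2. If $|w_i|\ne j$ and $\lambda=\mu$, then $\rho=\nu$; if $|w_i|\neq j$ and $\lambda=\nu$, then $\rho=\mu$. 3. Otherwise $|w_i|\ne j$ and $\gamma=\mu/\lambda$, $\gamma'=\nu/\lambda$ are both dominos. If $\gamma\cap\gamma'=\emptyset$, then $\rho=\lambda\cup\gamma\cup\gamma'$. If $\gamma\cap\gamma'$ is a single square $(k,l)$, then $\rho=\lambda\cup\gamma\cup\gamma'\cup\{(k+1,l+1)\}$. If $\gamma=\gamma'$ is horizontal, in row $k$, then $\rho$ is $\mu$ with two squares added to row $k+1$. If $\gamma=\gamma'$ is vertical, in column $l$, then $\rho$ is $\mu$ with two squares added to column $l+1$. Then $P(w)$ is the chain $\lambda(n,0)\subset\lambda(n,1)\subset\cdots\subset\lambda(n,n)$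 and $Q(w)$ is the chain $\lambda(0,n)\subset\lambda(1,n)\subset\cdots\subset\lambda(n,n)$. *)

theory Defs
  imports Complex_Main "HOL-Combinatorics.Permutations"
begin

section \<open>Signed permutations\<close>

text \<open>A signed permutation is extended by the identity outside \<open>{\<plusminus>1, \<dots>, \<plusminus>n}\<close>, so that equality in
  the group is equality of functions. The one-line notation is \<open>w 1, \<dots>, w n\<close>.\<close>

definition hyperoctahedral :: "nat \<Rightarrow> (int \<Rightarrow> int) set" where
  "hyperoctahedral n = {w. w permutes ({- int n..int n} - {0}) \<and> (\<forall>k. w (- k) = - w k)}"

definition gen_t :: "int \<Rightarrow> int" where
  "gen_t = transpose 1 (- 1)"

definition gen_s :: "nat \<Rightarrow> int \<Rightarrow> int" where
  "gen_s i = transpose (int i) (int i + 1) \<circ> transpose (- int i) (- (int i + 1))"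

definition generators :: "nat \<Rightarrow> (int \<Rightarrow> int) set" where
  "generators n = insert gen_t (gen_s ` {1..<n})"

definition len :: "nat \<Rightarrow> (int \<Rightarrow> int) \<Rightarrow> nat" where
  "len n w = (LEAST k. \<exists>gs. length gs = k \<and> set gs \<subseteq> generators n \<and> w = foldr (\<circ>) gs id)"

definition mu_sign :: "nat \<Rightarrow> (int \<Rightarrow> int) \<Rightarrow> (int \<Rightarrow> int) \<Rightarrow> int" where
  "mu_sign n v w = (- 1) ^ (len n v + len n w)"


section \<open>Young diagrams\<close>

text \<open>The square \<open>(i, j)\<close> is in row \<open>i\<close> and column \<open>j\<close>, both counted from 1.\<close>

type_synonym diagram = "(nat \<times> nat) set"

text \<open>A tableau is the list of the partitions in its chain, starting with the staircase.\<close>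

type_synonym tableau = "diagram list"

definition staircase :: "nat \<Rightarrow> diagram" where
  "staircase r = {(i, j). 1 \<le> i \<and> 1 \<le> j \<and> i + j \<le> r + 1}"

definition row_length :: "diagram \<Rightarrow> nat \<Rightarrow> nat" where
  "row_length D k = card {j. (k, j) \<in> D}"

definition col_length :: "diagram \<Rightarrow> nat \<Rightarrow> nat" where
  "col_length D l = card {i. (i, l) \<in> D}"

definition add_to_row :: "nat \<Rightarrow> diagram \<Rightarrow> diagram" where
  "add_to_row k D = D \<union> {(k, row_length D k + 1), (k, row_length D k + 2)}"

definition add_to_col :: "nat \<Rightarrow> diagram \<Rightarrow> diagram" where
  "add_to_col l D = D \<union> {(col_length D l + 1, l), (col_length D l + 2, l)}"


section \<open>Growth diagrams and the domino Robinson-Schensted map\<close>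

text \<open>The case of two nontrivial steps from \<open>L\<close> to \<open>M\<close> and to \<open>N\<close>: both
  \<open>M - L\<close> and \<open>N - L\<close> are dominos. In the last two branches these dominos coincide; then
  \<open>is_singleton (fst ` \<gamma>)\<close> says that \<open>\<gamma>\<close> lies in a single row.\<close>

definition domino_rule :: "diagram \<Rightarrow> diagram \<Rightarrow> diagram \<Rightarrow> diagram" where
  "domino_rule L M N =
     (let \<gamma> = M - L; \<gamma>' = N - L in
      if \<gamma> \<inter> \<gamma>' = {} then L \<union> \<gamma> \<union> \<gamma>'
      else if is_singleton (\<gamma> \<inter> \<gamma>') then
        L \<union> \<gamma> \<union> \<gamma>' \<union> (\<lambda>(k, l). (k + 1, l + 1)) ` (\<gamma> \<inter> \<gamma>')
      else if is_singleton (fst ` \<gamma>) then add_to_row (the_elem (fst ` \<gamma>) + 1) M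
      else add_to_col (the_elem (snd ` \<gamma>) + 1) M)"

text \<open>Here \<open>a\<close> is the letter \<open>w i\<close>, and \<open>L\<close>, \<open>M\<close>, \<open>N\<close> are the diagrams at
  \<open>(i - 1, j - 1)\<close>, \<open>(i - 1, j)\<close>, \<open>(i, j - 1)\<close>.\<close>

definition local_rule :: "int \<Rightarrow> nat \<Rightarrow> diagram \<Rightarrow> diagram \<Rightarrow> diagram \<Rightarrow> diagram" where
  "local_rule a j L M N =
     (if a = int j then add_to_row 1 L
      else if a = - int j then add_to_col 1 L
      else if L = M then N
      else if L = N then M
      else domino_rule L M N)"

fun growth :: "nat \<Rightarrow> (int \<Rightarrow> int) \<Rightarrow> nat \<Rightarrow> nat \<Rightarrow> diagram" where
  "growth r w 0 j = staircase r"
| "growth r w (Suc i) 0 = staircase r"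
| "growth r w (Suc i) (Suc j) =
     local_rule (w (int (Suc i))) (Suc j)
       (growth r w i j) (growth r w i (Suc j)) (growth r w (Suc i) j)"

definition P_tableau :: "nat \<Rightarrow> nat \<Rightarrow> (int \<Rightarrow> int) \<Rightarrow> tableau" where
  "P_tableau r n w = map (\<lambda>j. growth r w n j) [0..<n + 1]"

definition Q_tableau :: "nat \<Rightarrow> nat \<Rightarrow> (int \<Rightarrow> int) \<Rightarrow> tableau" where
  "Q_tableau r n w = map (\<lambda>i. growth r w i n) [0..<n + 1]"

definition domino_RS :: "nat \<Rightarrow> nat \<Rightarrow> (int \<Rightarrow> int) \<Rightarrow> tableau \<times> tableau" where
  "domino_RS r n w = (P_tableau r n w, Q_tableau r n w)"

end

theory Submission
  imports Defs "HOL-Library.Nat_Bijection"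
begin

text \<open>
  The parity of the length of \<open>w\<close> is that of the number of negative letters plus the number of
  inversions of \<open>\<bar>w 1\<bar>, \<dots>, \<bar>w n\<bar>\<close>. The inversions are the cells of the growth diagram with two
  nontrivial incoming steps. Give a diagram the weight \<open>\<Sum> (i + 1) j\<close> over its squares, and give
  a step \<open>L \<subseteq> M\<close> the number of pairs of a square of \<open>L\<close> and a smaller square of \<open>M - L\<close>, in an
  arbitrary total order and counting only the squares with \<open>i + j\<close> odd (each domino has one). For
  every cell of the growth diagram the sum of the weights of its four corners and its four sides
  turns out to be odd exactly when the cell is an inversion or a negative letter. Summed over all
  cells, everything inside the diagram and on its staircase borders cancels modulo 2, so the parity
  of the length is a function of \<open>P(w)\<close> plus a function of \<open>Q(w)\<close>.
\<close>

section \<open>The parity of the length function\<close>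

lemma hyperoctahedral_minus: "w \<in> hyperoctahedral n \<Longrightarrow> w (- k) = - w k"
  by (simp add: hyperoctahedral_def)

lemma hyperoctahedral_inj: "w \<in> hyperoctahedral n \<Longrightarrow> inj w"
  by (auto simp: hyperoctahedral_def dest: permutes_inj)

lemma hyperoctahedral_range:
  assumes "w \<in> hyperoctahedral n" "a \<in> {1..n}"
  shows "\<bar>w (int a)\<bar> \<in> {1..int n}"
proof -
  have "w permutes ({- int n..int n} - {0})"
    using assms(1) by (simp add: hyperoctahedral_def)
  moreover have "int a \<in> {- int n..int n} - {0}"
    using assms(2) by auto
  ultimately have "w (int a) \<in> {- int n..int n} - {0}"
    by (metis permutes_in_image)
  then show ?thesis by auto
qed

lemma hyperoctahedral_abs_inj:
  assumes "w \<in> hyperoctahedral n" "\<bar>w (int a)\<bar> = \<bar>w (int b)\<bar>"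
  shows "a = b"
proof -
  have "w (int a) = w (int b) \<or> w (int a) = w (- int b)"
    using assms hyperoctahedral_minus[OF assms(1), of "int b"] by linarith
  then show ?thesis
    using injD[OF hyperoctahedral_inj[OF assms(1)]] by fastforce
qed

lemma hyperoctahedral_id: "id \<in> hyperoctahedral n"
  unfolding hyperoctahedral_def using permutes_id by fastforce

lemma hyperoctahedral_comp:
  "v \<in> hyperoctahedral n \<Longrightarrow> w \<in> hyperoctahedral n \<Longrightarrow> v \<circ> w \<in> hyperoctahedral n"
  unfolding hyperoctahedral_def using permutes_compose by fastforce

lemma gen_t_in_hyperoctahedral: "n \<ge> 1 \<Longrightarrow> gen_t \<in> hyperoctahedral n"
  unfolding hyperoctahedral_def gen_t_def
  by (auto intro!: permutes_swap_id simp: transpose_def)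

lemma gen_s_in_hyperoctahedral:
  assumes "i \<in> {1..<n}"
  shows "gen_s i \<in> hyperoctahedral n"
proof -
  have "gen_s i permutes ({- int n..int n} - {0})"
    unfolding gen_s_def using assms
    by (intro permutes_compose permutes_swap_id) auto
  moreover have "gen_s i (- k) = - gen_s i k" for k
    using assms by (auto simp: gen_s_def transpose_def)
  ultimately show ?thesis by (simp add: hyperoctahedral_def)
qed

lemma generators_subset_hyperoctahedral: "n \<ge> 1 \<Longrightarrow> generators n \<subseteq> hyperoctahedral n"
  by (auto simp: generators_def gen_t_in_hyperoctahedral gen_s_in_hyperoctahedral)

lemma gen_s_int: "i \<ge> 1 \<Longrightarrow> gen_s i (int a) = int (transpose i (Suc i) a)"
  by (auto simp: gen_s_def transpose_def)

lemma foldr_comp_shift: "foldr (\<circ>) gs f = foldr (\<circ>) gs id \<circ> f"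
  by (induction gs) (simp_all add: comp_assoc)

lemma foldr_comp_in_hyperoctahedral:
  assumes "n \<ge> 1" "set gs \<subseteq> generators n"
  shows "foldr (\<circ>) gs id \<in> hyperoctahedral n"
  using assms(2)
  by (induction gs)
    (use generators_subset_hyperoctahedral[OF assms(1)] in
      \<open>auto intro: hyperoctahedral_comp simp: hyperoctahedral_id[unfolded id_def] hyperoctahedral_id\<close>)

section \<open>A statistic whose parity flips under every generator\<close>

definition neg_positions :: "nat \<Rightarrow> (int \<Rightarrow> int) \<Rightarrow> nat set" where
  "neg_positions n w = {a \<in> {1..n}. w (int a) < 0}"

definition abs_inversions :: "nat \<Rightarrow> (int \<Rightarrow> int) \<Rightarrow> (nat \<times> nat) set" where
  "abs_inversions n w =
     {(a, b). a \<in> {1..n} \<and> b \<in> {1..n} \<and> a < b \<and> \<bar>w (int b)\<bar> < \<bar>w (int a)\<bar>}"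

text \<open>This is not the length: the signed permutation with letters -1, -2 has count 2 and
  length 4. Only the parities agree.\<close>

definition parity_count :: "nat \<Rightarrow> (int \<Rightarrow> int) \<Rightarrow> nat" where
  "parity_count n w = card (neg_positions n w) + card (abs_inversions n w)"

lemma finite_neg_positions: "finite (neg_positions n w)"
  by (simp add: neg_positions_def)

lemma finite_abs_inversions: "finite (abs_inversions n w)"
  by (rule finite_subset[of _ "{1..n} \<times> {1..n}"]) (auto simp: abs_inversions_def)

lemma even_card_flip:
  assumes "finite A" "finite B" "card (A - {x}) = card (B - {x})" "x \<in> A \<longleftrightarrow> x \<notin> B"
  shows "even (card A) \<longleftrightarrow> odd (card B)"
proof -
  have "card X = card (X - {x}) + of_bool (x \<in> X)" if "finite X" for X
    using card.remove[OF that, of x] by (cases "x \<in> X") (simp_all only: of_bool_eq Suc_eq_plus1 add_0_right Diff_insert0 Diff_empty simp_thms)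
  then have "card A = card (A - {x}) + of_bool (x \<in> A)" "card B = card (A - {x}) + of_bool (x \<in> B)"
    using assms(1-3) by metis+
  then show ?thesis using assms(4) by (cases "x \<in> A") simp_all
qed

lemma parity_count_gen_t:
  assumes w: "w \<in> hyperoctahedral n" and n: "n \<ge> 1"
  shows "even (parity_count n (w \<circ> gen_t)) \<longleftrightarrow> odd (parity_count n w)"
proof -
  have t: "gen_t (int a) = (if a = 1 then - 1 else int a)" for a
    by (auto simp: gen_t_def transpose_def)
  have abs: "\<bar>(w \<circ> gen_t) (int a)\<bar> = \<bar>w (int a)\<bar>" for a
    using hyperoctahedral_minus[OF w, of 1] by (simp add: t)
  have "abs_inversions n (w \<circ> gen_t) = abs_inversions n w"
    unfolding abs_inversions_def abs by simp
  moreover have "neg_positions n (w \<circ> gen_t) - {1} = neg_positions n w - {1}"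
    by (auto simp: neg_positions_def t)
  moreover have "1 \<in> neg_positions n (w \<circ> gen_t) \<longleftrightarrow> 1 \<notin> neg_positions n w"
    using hyperoctahedral_range[OF w, of 1] hyperoctahedral_minus[OF w, of 1] n
    by (auto simp: neg_positions_def gen_t_def transpose_def)
  ultimately show ?thesis
    using even_card_flip[OF finite_neg_positions finite_neg_positions, of n "w \<circ> gen_t" 1 n w]
    by (auto simp: parity_count_def)
qed

text \<open>Composition on the right permutes positions. An adjacent transposition keeps the order
  of every pair of positions except \<open>(i, Suc i)\<close>, so only this pair enters or leaves
  the inversions, while the negative positions are merely relabelled.\<close>

lemma parity_count_gen_s:
  assumes w: "w \<in> hyperoctahedral n" and i: "i \<in> {1..<n}"
  shows "even (parity_count n (w \<circ> gen_s i)) \<longleftrightarrow> odd (parity_count n w)"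
proof -
  define \<sigma> where "\<sigma> = transpose i (Suc i)"
  define p where "p = (\<lambda>(a, b). (\<sigma> a, \<sigma> b))"
  have ws: "(w \<circ> gen_s i) (int a) = w (int (\<sigma> a))" for a
    using i gen_s_int[of i a] by (simp add: \<sigma>_def)
  have \<sigma>\<sigma>: "\<sigma> (\<sigma> a) = a" for a by (simp add: \<sigma>_def)
  have \<sigma>_range: "\<sigma> a \<in> {1..n} \<longleftrightarrow> a \<in> {1..n}" for a
    using i by (auto simp: \<sigma>_def transpose_def)
  have \<sigma>_less: "\<sigma> a < \<sigma> b \<and> (\<sigma> a, \<sigma> b) \<noteq> (i, Suc i)"
    if "a < b" "(a, b) \<noteq> (i, Suc i)" for a b
    using that by (auto simp: \<sigma>_def transpose_def)
  have inj_\<sigma>: "inj \<sigma>" by (simp add: \<sigma>_def)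
  have inj_p: "inj p" by (auto simp: p_def inj_on_def dest: injD[OF inj_\<sigma>])
  let ?x = "(i, Suc i)"
  \<comment> \<open>A general \<open>v\<close> is taken because both \<open>w\<close> and
    \<open>w \<circ> gen_s i\<close> are needed: \<open>gen_s i\<close> is an involution, so this
    gives injections in both directions and hence equal cardinalities.\<close>
  have sub: "p ` (abs_inversions n (v \<circ> gen_s i) - {?x}) \<subseteq> abs_inversions n v - {?x}"
    if "\<And>a. (v \<circ> gen_s i) (int a) = v (int (\<sigma> a))" for v
    unfolding abs_inversions_def that p_def using \<sigma>_less \<sigma>_range by auto
  have w2: "w = (w \<circ> gen_s i) \<circ> gen_s i"
    using i by (auto simp: gen_s_def fun_eq_iff transpose_def)
  have ws2: "((w \<circ> gen_s i) \<circ> gen_s i) (int a) = (w \<circ> gen_s i) (int (\<sigma> a))" for a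
    unfolding w2[symmetric] ws \<sigma>\<sigma> ..
  have le1: "card (abs_inversions n (w \<circ> gen_s i) - {?x}) \<le> card (abs_inversions n w - {?x})"
    by (rule card_inj_on_le[OF _ sub[OF ws]])
      (auto intro: inj_on_subset[OF inj_p] simp: finite_abs_inversions)
  have le2: "card (abs_inversions n w - {?x}) \<le> card (abs_inversions n (w \<circ> gen_s i) - {?x})"
    by (rule card_inj_on_le[OF _ sub[OF ws2, folded w2]])
      (auto intro: inj_on_subset[OF inj_p] simp: finite_abs_inversions)
  have "?x \<in> abs_inversions n (w \<circ> gen_s i) \<longleftrightarrow> ?x \<notin> abs_inversions n w"
    unfolding abs_inversions_def mem_Collect_eq prod.case ws
    using i hyperoctahedral_abs_inj[OF w, of i "Suc i"] by (force simp: \<sigma>_def)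
  with le1 le2 have inv: "even (card (abs_inversions n (w \<circ> gen_s i))) \<longleftrightarrow> odd (card (abs_inversions n w))"
    by (intro even_card_flip[where x = ?x] finite_abs_inversions le_antisym)
  have "neg_positions n w = \<sigma> ` neg_positions n (w \<circ> gen_s i)"
  proof (intro subset_antisym subsetI)
    fix a assume "a \<in> neg_positions n w"
    then have "\<sigma> a \<in> neg_positions n (w \<circ> gen_s i)"
      unfolding neg_positions_def mem_Collect_eq ws \<sigma>_range \<sigma>\<sigma> .
    then show "a \<in> \<sigma> ` neg_positions n (w \<circ> gen_s i)"
      by (metis \<sigma>\<sigma> imageI)
  next
    fix a assume "a \<in> \<sigma> ` neg_positions n (w \<circ> gen_s i)"
    then obtain b where "a = \<sigma> b" "b \<in> neg_positions n (w \<circ> gen_s i)" by blast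
    then show "a \<in> neg_positions n w"
      unfolding neg_positions_def mem_Collect_eq ws by (simp only: \<sigma>_range)
  qed
  then have "card (neg_positions n w) = card (neg_positions n (w \<circ> gen_s i))"
    using card_image[OF inj_on_subset[OF inj_\<sigma> subset_UNIV]] by metis
  with inv show ?thesis by (simp only: parity_count_def even_add) blast
qed

text \<open>The induction removes the last generator, since the parity flips are known for
  composition on the right.\<close>

lemma parity_count_word:
  assumes "n \<ge> 1" "set gs \<subseteq> generators n"
  shows "even (parity_count n (foldr (\<circ>) gs id)) \<longleftrightarrow> even (length gs)"
  using assms(2)
proof (induction gs rule: rev_induct)
  case Nil
  have "neg_positions n id = {}" "abs_inversions n id = {}"
    by (auto simp: neg_positions_def abs_inversions_def)
  then show ?case by (simp add: parity_count_def id_def)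
next
  case (snoc g gs)
  let ?v = "foldr (\<circ>) gs id"
  have v: "?v \<in> hyperoctahedral n"
    using snoc.prems by (intro foldr_comp_in_hyperoctahedral assms(1)) auto
  have "foldr (\<circ>) (gs @ [g]) id = ?v \<circ> g"
    by (simp add: foldr_comp_shift[of gs g])
  moreover have "even (parity_count n (?v \<circ> g)) \<longleftrightarrow> odd (parity_count n ?v)"
    using snoc.prems parity_count_gen_t[OF v assms(1)] parity_count_gen_s[OF v]
    by (auto simp: generators_def)
  moreover have "even (parity_count n ?v) \<longleftrightarrow> even (length gs)"
    using snoc.prems by (intro snoc.IH) auto
  ultimately show ?case by (simp only: length_append_singleton even_Suc)
qed

section \<open>The generators generate the group\<close>

lemma increasing_hyperoctahedral_is_id:
  assumes w: "w \<in> hyperoctahedral n" and pos: "n \<ge> 1 \<Longrightarrow> w 1 > 0"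
    and inc: "\<And>i. i \<in> {1..<n} \<Longrightarrow> w (int i) < w (int i + 1)"
  shows "w = id"
proof -
  have ge: "w (int a) \<ge> int a" if "a \<in> {1..n}" for a
    using that
  proof (induction a)
    case (Suc a)
    show ?case
    proof (cases "a = 0")
      case True
      with pos Suc.prems show ?thesis by auto
    next
      case False
      then have "int a \<le> w (int a)" "w (int a) < w (int a + 1)"
        using Suc inc[of a] by auto
      then show ?thesis by (simp add: add.commute)
    qed
  qed simp
  \<comment> \<open>The reverse bound is obtained from the right end, where \<open>w n\<close> is at
    most \<open>n\<close>; \<open>d\<close> is the distance from that end.\<close>
  have le: "w (int (n - d)) \<le> int (n - d)" if "d < n" for d
    using that
  proof (induction d)
    case 0
    then show ?case using hyperoctahedral_range[OF w, of n] by auto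
  next
    case (Suc d)
    then have "w (int (n - Suc d)) < w (int (n - Suc d) + 1)"
      by (intro inc) auto
    moreover have "int (n - Suc d) + 1 = int (n - d)" using Suc.prems by auto
    ultimately show ?case using Suc by auto
  qed
  have eq: "w (int a) = int a" if "a \<in> {1..n}" for a
    using ge[OF that] le[of "n - a"] that by auto
  have out: "w k = k" if "k \<notin> {- int n..int n} - {0}" for k
    using w that unfolding hyperoctahedral_def by (auto simp: permutes_def)
  have "w k = k" for k
  proof (cases "k \<in> {- int n..int n} - {0}")
    case True
    then have "nat \<bar>k\<bar> \<in> {1..n}" by auto
    from eq[OF this] show ?thesis
      using hyperoctahedral_minus[OF w, of k] by (cases "k \<ge> 0") auto
  qed (rule out)
  then show ?thesis by auto
qed

text \<open>\<open>len\<close> is a \<open>LEAST\<close>, so it carries information only once some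
  word for \<open>w\<close> is known to exist. The word comes from sorting: as long as
  \<open>w 1\<close> is negative or two adjacent letters descend, the corresponding generator is
  applied.\<close>

lemma hyperoctahedral_generated:
  assumes n: "n \<ge> 1" and w: "w \<in> hyperoctahedral n"
  shows "\<exists>gs. set gs \<subseteq> generators n \<and> w = foldr (\<circ>) gs id"
proof -
  \<comment> \<open>A bounded quantity that grows during the sorting: making a negative
    \<open>w 1\<close> positive adds \<open>- 2 * w 1\<close>, and exchanging a descent at
    \<open>i\<close> adds \<open>w i - w (i + 1)\<close>.\<close>
  define m :: "(int \<Rightarrow> int) \<Rightarrow> int" where "m = (\<lambda>w. \<Sum>a\<in>{1..n}. int a * w (int a))"
  have bound: "m v \<le> int n * (int n * int n)" if "v \<in> hyperoctahedral n" for v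
  proof -
    have "m v \<le> (\<Sum>a\<in>{1..n}. int n * int n)"
      unfolding m_def
    proof (rule sum_mono)
      fix a assume a: "a \<in> {1..n}"
      then have "v (int a) \<le> int n" using hyperoctahedral_range[OF that a] by auto
      then have "int a * v (int a) \<le> int a * int n" by (simp add: mult_left_mono)
      also have "\<dots> \<le> int n * int n" using a by (simp add: mult_right_mono)
      finally show "int a * v (int a) \<le> int n * int n" .
    qed
    then show ?thesis by simp
  qed
  have gen: "\<exists>gs. set gs \<subseteq> generators n \<and> v \<circ> g = foldr (\<circ>) gs id \<Longrightarrow> g \<in> generators n \<Longrightarrow>
      g \<circ> g = id \<Longrightarrow> \<exists>gs. set gs \<subseteq> generators n \<and> v = foldr (\<circ>) gs id" for v g
  proof -
    assume "\<exists>gs. set gs \<subseteq> generators n \<and> v \<circ> g = foldr (\<circ>) gs id"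
    then obtain gs where gs: "set gs \<subseteq> generators n" "v \<circ> g = foldr (\<circ>) gs id" by blast
    assume g: "g \<in> generators n" "g \<circ> g = id"
    have "v = (v \<circ> g) \<circ> g" by (simp add: comp_assoc g(2))
    also have "\<dots> = foldr (\<circ>) (gs @ [g]) id"
      by (simp add: foldr_comp_shift[of gs g] gs(2))
    finally show ?thesis using gs(1) g(1) by (intro exI[of _ "gs @ [g]"]) auto
  qed
  show ?thesis using w
  proof (induction "nat (int n * (int n * int n) - m w)" arbitrary: w rule: less_induct)
    case less
    have step: "\<exists>gs. set gs \<subseteq> generators n \<and> w = foldr (\<circ>) gs id"
      if "g \<in> generators n" "g \<circ> g = id" "m (w \<circ> g) > m w" for g
    proof (rule gen[OF less.hyps that(1,2)])
      show *: "w \<circ> g \<in> hyperoctahedral n"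
        using that(1) less.prems generators_subset_hyperoctahedral[OF n]
        by (auto intro: hyperoctahedral_comp)
      show "nat (int n * (int n * int n) - m (w \<circ> g)) < nat (int n * (int n * int n) - m w)"
        using bound[OF *] that(3) by linarith
    qed
    consider "w 1 < 0" | i where "i \<in> {1..<n}" "w (int i) > w (int i + 1)" | "w = id"
    proof -
      have "w 1 \<noteq> 0" using hyperoctahedral_range[OF less.prems, of 1] n by auto
      moreover have "w (int i) \<noteq> w (int i + 1)" for i
        using injD[OF hyperoctahedral_inj[OF less.prems], of "int i" "int i + 1"] by auto
      ultimately show ?thesis
        using that increasing_hyperoctahedral_is_id[OF less.prems] by (meson linorder_neqE)
    qed
    then show ?case
    proof cases
      case 1
      show ?thesis
      proof (rule step[of gen_t])
        show "gen_t \<in> generators n" by (simp add: generators_def)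
        show "gen_t \<circ> gen_t = id" by (simp add: gen_t_def)
        have "int a * w (int a) \<le> int a * (w \<circ> gen_t) (int a)" for a
          using 1 hyperoctahedral_minus[OF less.prems, of 1] by (auto simp: gen_t_def transpose_def)
        moreover have "int 1 * w (int 1) < int 1 * (w \<circ> gen_t) (int 1)"
          using 1 hyperoctahedral_minus[OF less.prems, of 1] by (auto simp: gen_t_def)
        ultimately show "m w < m (w \<circ> gen_t)"
          unfolding m_def using n by (intro sum_strict_mono_ex1) (auto intro!: bexI[of _ 1])
      qed
    next
      case (2 i)
      show ?thesis
      proof (rule step[of "gen_s i"])
        show "gen_s i \<in> generators n" using 2 by (simp add: generators_def)
        show "gen_s i \<circ> gen_s i = id"
          using 2 by (auto simp: gen_s_def fun_eq_iff transpose_def)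
        have split: "m v = (\<Sum>a\<in>{1..n} - {i, Suc i}. int a * v (int a))
            + (int i * v (int i) + (int i + 1) * v (int i + 1))" for v
        proof -
          have "m v = (\<Sum>a\<in>{1..n} - {i, Suc i}. int a * v (int a)) + (\<Sum>a\<in>{i, Suc i}. int a * v (int a))"
            unfolding m_def using 2 by (intro sum.subset_diff) auto
          then show ?thesis by (simp add: algebra_simps)
        qed
        have rest: "(\<Sum>a\<in>{1..n} - {i, Suc i}. int a * (w \<circ> gen_s i) (int a))
            = (\<Sum>a\<in>{1..n} - {i, Suc i}. int a * w (int a))"
          using 2 by (intro sum.cong) (auto simp: gen_s_int transpose_def)
        have "(w \<circ> gen_s i) (int i) = w (int i + 1)" "(w \<circ> gen_s i) (int i + 1) = w (int i)"
          using 2 by (auto simp: gen_s_def transpose_def)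
        with split[of "w \<circ> gen_s i"] split[of w] rest 2
        show "m w < m (w \<circ> gen_s i)" by (simp add: algebra_simps)
      qed
    next
      case 3
      then show ?thesis by (intro exI[of _ "[]"]) auto
    qed
  qed
qed

lemma even_len_iff:
  assumes "n \<ge> 1" "w \<in> hyperoctahedral n"
  shows "even (len n w) \<longleftrightarrow> even (parity_count n w)"
proof -
  have "\<exists>gs. length gs = len n w \<and> set gs \<subseteq> generators n \<and> w = foldr (\<circ>) gs id"
    unfolding len_def by (rule LeastI_ex) (use hyperoctahedral_generated[OF assms] in blast)
  then show ?thesis using parity_count_word[OF assms(1)] by metis
qed


section \<open>The local rules modulo 2\<close>

definition young :: "diagram \<Rightarrow> bool" where
  "young D \<longleftrightarrow> finite D \<and> D \<subseteq> {1..} \<times> {1..} \<and>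
     (\<forall>i j i' j'. (i, j) \<in> D \<longrightarrow> 1 \<le> i' \<longrightarrow> i' \<le> i \<longrightarrow> 1 \<le> j' \<longrightarrow> j' \<le> j \<longrightarrow> (i', j') \<in> D)"

definition domino :: "diagram \<Rightarrow> bool" where
  "domino \<gamma> \<longleftrightarrow> (\<exists>k l. \<gamma> = {(k, l), (k, l + 1)} \<or> \<gamma> = {(k, l), (k + 1, l)})"

definition domino_step :: "diagram \<Rightarrow> diagram \<Rightarrow> bool" where
  "domino_step L M \<longleftrightarrow> L \<subseteq> M \<and> domino (M - L)"

text \<open>Modulo 2, a horizontal domino in row \<open>k\<close> must weigh \<open>k - 1\<close> and a vertical one in column \<open>l\<close>
  must weigh \<open>l\<close> for the local rules to work out; this forces the weight \<open>(i - 1) j\<close> on squares, up to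
  the choice at \<open>(1, 1)\<close>. The factor \<open>i + 1\<close> avoids truncated subtraction.\<close>

definition diagram_weight :: "diagram \<Rightarrow> nat" where
  "diagram_weight D = (\<Sum>(i, j)\<in>D. (i + 1) * j)"

text \<open>\<open>prod_encode\<close> acts only as an injection into the naturals, which provides
  the total order on squares.\<close>

definition square_inv :: "nat \<times> nat \<Rightarrow> nat \<times> nat \<Rightarrow> nat" where
  "square_inv p q = of_bool (odd (fst p + snd p) \<and> odd (fst q + snd q) \<and> prod_encode q < prod_encode p)"

definition step_inv :: "diagram \<Rightarrow> diagram \<Rightarrow> nat" where
  "step_inv L M = (\<Sum>q\<in>M - L. \<Sum>p\<in>L. square_inv p q)"

text \<open>\<open>L\<close>, \<open>M\<close>, \<open>N\<close>, \<open>R\<close> are placed as in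
  \<open>local_rule\<close>, with \<open>R\<close> the new corner: \<open>j\<close> grows along
  \<open>L M\<close> and \<open>N R\<close>, and \<open>i\<close> grows along \<open>L N\<close> and
  \<open>M R\<close>.\<close>

definition cell_weight :: "diagram \<Rightarrow> diagram \<Rightarrow> diagram \<Rightarrow> diagram \<Rightarrow> nat" where
  "cell_weight L M N R = step_inv L M + step_inv N R + diagram_weight L + diagram_weight M
     + diagram_weight N + diagram_weight R + step_inv L N + step_inv M R"

section \<open>Young diagrams and the addition of squares\<close>

lemma youngD: "young D \<Longrightarrow> (i, j) \<in> D \<Longrightarrow> 1 \<le> i' \<Longrightarrow> i' \<le> i \<Longrightarrow> 1 \<le> j' \<Longrightarrow> j' \<le> j \<Longrightarrow> (i', j') \<in> D"
  unfolding young_def by blast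

lemma young_pos: "young D \<Longrightarrow> (i, j) \<in> D \<Longrightarrow> 1 \<le> i \<and> 1 \<le> j"
  unfolding young_def by blast

lemma young_finite: "young D \<Longrightarrow> finite D"
  unfolding young_def by blast

text \<open>A row is an initial segment of columns, so its cardinality is its last column. This
  turns \<open>row_length\<close> into a membership test.\<close>

lemma young_row:
  assumes "young D" "k \<ge> 1"
  shows "(k, j) \<in> D \<longleftrightarrow> 1 \<le> j \<and> j \<le> row_length D k"
proof -
  let ?S = "{j. (k, j) \<in> D}"
  have fin: "finite ?S"
    by (rule finite_subset[of _ "snd ` D"]) (use young_finite[OF assms(1)] in force)+
  have "?S = {1..card ?S}"
  proof (cases "?S = {}")
    case False
    define m where "m = Max ?S"
    have m: "m \<in> ?S" "\<And>j. j \<in> ?S \<Longrightarrow> j \<le> m"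
      using Max_in[OF fin False] Max_ge[OF fin] by (simp_all add: m_def)
    have "?S = {1..m}"
    proof (intro subset_antisym subsetI)
      fix j assume "j \<in> ?S"
      then show "j \<in> {1..m}" using m(2) young_pos[OF assms(1)] by auto
    next
      fix j assume "j \<in> {1..m}"
      then show "j \<in> ?S"
        using youngD[OF assms(1), of k m k j] m(1) assms(2) by auto
    qed
    then show ?thesis by (metis card_atLeastAtMost diff_Suc_1)
  qed simp
  then show ?thesis unfolding row_length_def by (metis atLeastAtMost_iff mem_Collect_eq)
qed

lemma young_col:
  assumes "young D" "l \<ge> 1"
  shows "(i, l) \<in> D \<longleftrightarrow> 1 \<le> i \<and> i \<le> col_length D l"
proof -
  let ?S = "{i. (i, l) \<in> D}"
  have fin: "finite ?S"
    by (rule finite_subset[of _ "fst ` D"]) (use young_finite[OF assms(1)] in force)+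
  have "?S = {1..card ?S}"
  proof (cases "?S = {}")
    case False
    define m where "m = Max ?S"
    have m: "m \<in> ?S" "\<And>i. i \<in> ?S \<Longrightarrow> i \<le> m"
      using Max_in[OF fin False] Max_ge[OF fin] by (simp_all add: m_def)
    have "?S = {1..m}"
    proof (intro subset_antisym subsetI)
      fix i assume "i \<in> ?S"
      then show "i \<in> {1..m}" using m(2) young_pos[OF assms(1)] by auto
    next
      fix i assume "i \<in> {1..m}"
      then show "i \<in> ?S"
        using youngD[OF assms(1), of m l i l] m(1) assms(2) by auto
    qed
    then show ?thesis by (metis card_atLeastAtMost diff_Suc_1)
  qed simp
  then show ?thesis unfolding col_length_def by (metis atLeastAtMost_iff mem_Collect_eq)
qed

lemma young_staircase: "young (staircase r)"
proof -
  have "finite (staircase r)"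
    by (rule finite_subset[of _ "{..r + 1} \<times> {..r + 1}"]) (auto simp: staircase_def)
  then show ?thesis by (auto simp: young_def staircase_def)
qed

lemma young_Un: "young M \<Longrightarrow> young N \<Longrightarrow> young (M \<union> N)"
  unfolding young_def by (intro conjI allI impI) (blast+)

lemma young_add_corner:
  assumes "young D" "i \<ge> 1" "j \<ge> 1" "i > 1 \<Longrightarrow> (i - 1, j) \<in> D" "j > 1 \<Longrightarrow> (i, j - 1) \<in> D"
  shows "young (insert (i, j) D)"
proof -
  have "(a, b) \<in> insert (i, j) D" if "1 \<le> a" "a \<le> i" "1 \<le> b" "b \<le> j" for a b
  proof (cases "a < i")
    case True
    then have "(a, b) \<in> D" using youngD[OF assms(1) assms(4), of a b] that by auto
    then show ?thesis by simp
  next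
    case False
    then have "a = i" using that by simp
    then show ?thesis using youngD[OF assms(1) assms(5), of a b] that
      by (cases "b < j") auto
  qed
  then show ?thesis
    using assms(1-3) unfolding young_def by (intro conjI allI impI) blast+
qed

lemma young_add_to_row:
  assumes "young D" "k \<ge> 1" "k > 1 \<Longrightarrow> row_length D k + 2 \<le> row_length D (k - 1)"
  shows "young (add_to_row k D)"
    and "add_to_row k D - D = {(k, row_length D k + 1), (k, row_length D k + 2)}"
proof -
  let ?m = "row_length D k"
  have up: "(k - 1, j) \<in> D" if "k > 1" "1 \<le> j" "j \<le> ?m + 2" for j
    using young_row[OF assms(1), of "k - 1" j] that assms(3) by auto
  have 1: "young (insert (k, ?m + 1) D)"
    using assms(1,2) up young_row[OF assms(1,2), of ?m] by (intro young_add_corner) auto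
  have "young (insert (k, ?m + 2) (insert (k, ?m + 1) D))"
    using assms(2) up by (intro young_add_corner[OF 1]) auto
  then show "young (add_to_row k D)" by (simp add: add_to_row_def insert_commute)
  show "add_to_row k D - D = {(k, ?m + 1), (k, ?m + 2)}"
    using young_row[OF assms(1,2)] by (auto simp: add_to_row_def)
qed

lemma young_add_to_col:
  assumes "young D" "l \<ge> 1" "l > 1 \<Longrightarrow> col_length D l + 2 \<le> col_length D (l - 1)"
  shows "young (add_to_col l D)"
    and "add_to_col l D - D = {(col_length D l + 1, l), (col_length D l + 2, l)}"
proof -
  let ?m = "col_length D l"
  have up: "(i, l - 1) \<in> D" if "l > 1" "1 \<le> i" "i \<le> ?m + 2" for i
    using young_col[OF assms(1), of "l - 1" i] that assms(3) by auto
  have 1: "young (insert (?m + 1, l) D)"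
    using assms(1,2) up young_col[OF assms(1,2), of ?m] by (intro young_add_corner) auto
  have "young (insert (?m + 2, l) (insert (?m + 1, l) D))"
    using assms(2) up by (intro young_add_corner[OF 1]) auto
  then show "young (add_to_col l D)" by (simp add: add_to_col_def insert_commute)
  show "add_to_col l D - D = {(?m + 1, l), (?m + 2, l)}"
    using young_col[OF assms(1,2)] by (auto simp: add_to_col_def)
qed

section \<open>Weights of the possible kinds of cells\<close>

lemma diagram_weight_step:
  assumes "finite M" "L \<subseteq> M"
  shows "diagram_weight M = diagram_weight L + diagram_weight (M - L)"
  unfolding diagram_weight_def using sum.subset_diff[OF assms(2,1)] by (metis add.commute)

lemma step_inv_refl [simp]: "step_inv L L = 0"
  by (simp add: step_inv_def)

text \<open>Each domino has exactly one square of odd coordinate sum. By disjointness these two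
  squares differ, so exactly one of the two comparisons holds.\<close>

lemma domino_inv_swap:
  assumes "domino \<gamma>" "domino \<gamma>'" "\<gamma> \<inter> \<gamma>' = {}"
  shows "(\<Sum>q\<in>\<gamma>. \<Sum>p\<in>\<gamma>'. square_inv p q) + (\<Sum>q\<in>\<gamma>'. \<Sum>p\<in>\<gamma>. square_inv p q) = 1"
proof -
  have one: "\<exists>a b. \<gamma> = {a, b} \<and> odd (fst a + snd a) \<and> even (fst b + snd b)" if \<gamma>: "domino \<gamma>" for \<gamma>
  proof -
    obtain a b where "\<gamma> = {a, b}" "odd (fst a + snd a) \<longleftrightarrow> even (fst b + snd b)"
      using \<gamma> unfolding domino_def by (auto; fastforce)
    then show ?thesis by (metis insert_commute)
  qed
  obtain a b where ab: "\<gamma> = {a, b}" "odd (fst a + snd a)" "even (fst b + snd b)"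
    using one[OF assms(1)] by blast
  obtain c d where cd: "\<gamma>' = {c, d}" "odd (fst c + snd c)" "even (fst d + snd d)"
    using one[OF assms(2)] by blast
  have "a \<noteq> b" "c \<noteq> d" using ab cd by auto
  have "a \<noteq> c" using assms(3) ab cd by auto
  then have "prod_encode a \<noteq> prod_encode c" by (simp add: inj_eq[OF inj_prod_encode])
  then have "square_inv c a + square_inv a c = 1"
    using ab(2) cd(2) by (simp add: square_inv_def)
  moreover have "square_inv p b = 0" "square_inv p d = 0" "square_inv b p = 0" "square_inv d p = 0" for p
    using ab(3) cd(3) by (simp_all add: square_inv_def)
  ultimately show ?thesis
    unfolding ab(1) cd(1) using \<open>a \<noteq> b\<close> \<open>c \<noteq> d\<close> by simp
qed

text \<open>Modulo 2 the corner weights cancel. Opposite sides add the same domino to diagrams that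
  differ by the other domino, so their inversion counts cancel up to the two mutual terms, whose sum
  is 1 by \<open>domino_inv_swap\<close>.\<close>

lemma cell_weight_disjoint:
  assumes "finite M" "finite N" "domino_step L M" "domino_step L N" "(M - L) \<inter> (N - L) = {}"
  shows "odd (cell_weight L M N (M \<union> N))"
proof -
  let ?R = "M \<union> N" and ?g = "M - L" and ?h = "N - L"
  have sub: "L \<subseteq> M" "L \<subseteq> N" and dom: "domino ?g" "domino ?h"
    using assms(3,4) by (auto simp: domino_step_def)
  have fin: "finite L" using sub assms(1) finite_subset by blast
  have d: "?R - M = ?h" "?R - N = ?g" using sub assms(5) by blast+
  have MN: "M = L \<union> ?g" "N = L \<union> ?h" using sub by blast+
  have sM: "(\<Sum>p\<in>M. f p) = (\<Sum>p\<in>L. f p) + (\<Sum>p\<in>?g. f p)" for f :: "_ \<Rightarrow> nat"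
    by (subst MN(1), rule sum.union_disjoint) (use fin assms(1) in auto)
  have sN: "(\<Sum>p\<in>N. f p) = (\<Sum>p\<in>L. f p) + (\<Sum>p\<in>?h. f p)" for f :: "_ \<Rightarrow> nat"
    by (subst MN(2), rule sum.union_disjoint) (use fin assms(2) in auto)
  have "diagram_weight M = diagram_weight L + diagram_weight ?g"
       "diagram_weight N = diagram_weight L + diagram_weight ?h"
       "diagram_weight ?R = diagram_weight M + diagram_weight ?h"
    using diagram_weight_step[OF assms(1) sub(1)] diagram_weight_step[OF assms(2) sub(2)]
      diagram_weight_step[of ?R M] assms(1,2) d by auto
  moreover have "step_inv M ?R = step_inv L N + (\<Sum>q\<in>?h. \<Sum>p\<in>?g. square_inv p q)"
    unfolding step_inv_def d sM by (simp add: sum.distrib)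
  moreover have "step_inv N ?R = step_inv L M + (\<Sum>q\<in>?g. \<Sum>p\<in>?h. square_inv p q)"
    unfolding step_inv_def d sN by (simp add: sum.distrib)
  moreover note domino_inv_swap[OF dom assms(5)]
  ultimately show ?thesis
    unfolding cell_weight_def by presburger
qed

text \<open>The two dominos share the square \<open>(k, l)\<close>, and \<open>R\<close> completes
  the 2 by 2 block.\<close>

lemma cell_weight_block:
  assumes "finite L" and disj: "(k, l) \<notin> L" "(k, l + 1) \<notin> L" "(k + 1, l) \<notin> L" "(k + 1, l + 1) \<notin> L"
    and M: "M = L \<union> {(k, l), (k, l + 1)}" and N: "N = L \<union> {(k, l), (k + 1, l)}"
    and R: "R = L \<union> {(k, l), (k, l + 1), (k + 1, l), (k + 1, l + 1)}"
  shows "odd (cell_weight L M N R)"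
proof -
  let ?a = "(k, l)" and ?b = "(k, l + 1)" and ?c = "(k + 1, l)" and ?d = "(k + 1, l + 1)"
  have d: "M - L = {?a, ?b}" "N - L = {?a, ?c}" "R - M = {?c, ?d}" "R - N = {?b, ?d}"
    using disj by (auto simp: M N R)
  define \<sigma> where "\<sigma> q = (\<Sum>p\<in>L. square_inv p q)" for q
  have 1: "step_inv L M = \<sigma> ?a + \<sigma> ?b" "step_inv L N = \<sigma> ?a + \<sigma> ?c"
    unfolding step_inv_def d by (simp_all add: \<sigma>_def)
  have 2: "step_inv M R = \<sigma> ?c + \<sigma> ?d + square_inv ?a ?c + square_inv ?b ?c + square_inv ?a ?d + square_inv ?b ?d"
    unfolding step_inv_def d unfolding M using assms(1) disj by (simp add: \<sigma>_def)
  have 3: "step_inv N R = \<sigma> ?b + \<sigma> ?d + square_inv ?a ?b + square_inv ?c ?b + square_inv ?a ?d + square_inv ?c ?d"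
    unfolding step_inv_def d unfolding N using assms(1) disj by (simp add: \<sigma>_def)
  have w: "diagram_weight M = diagram_weight L + (k + 1) * l + (k + 1) * (l + 1)"
    "diagram_weight N = diagram_weight L + (k + 1) * l + (k + 2) * l"
    "diagram_weight R = diagram_weight L + (k + 1) * l + (k + 1) * (l + 1) + (k + 2) * l + (k + 2) * (l + 1)"
    unfolding diagram_weight_def M N R using assms(1) disj by simp_all
  have "prod_encode ?b \<noteq> prod_encode ?c" by (simp add: inj_eq[OF inj_prod_encode])
  \<comment> \<open>These two squares have the same coordinate sum, so they are compared exactly
    when that sum \<open>k + l + 1\<close> is odd.\<close>
  then have swap: "square_inv ?b ?c + square_inv ?c ?b = of_bool (even (k + l))"
    by (auto simp: square_inv_def)
  have zero: "square_inv ?a ?b = 0" "square_inv ?a ?c = 0" "square_inv ?b ?d = 0" "square_inv ?c ?d = 0"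
    by (auto simp: square_inv_def)
  \<comment> \<open>What is not doubled is the weight of the two diagonal squares, congruent to
    \<open>k + l\<close>, and the comparison of the other two, which is 1 exactly for even
    \<open>k + l\<close>. Together they are always odd.\<close>
  have "cell_weight L M N R = 2 * (2 * diagram_weight L + \<sigma> ?a + \<sigma> ?b + \<sigma> ?c + \<sigma> ?d + square_inv ?a ?d
      + (k + 1) * l + (k + 1) * (l + 1) + (k + 2) * l) + ((k + 1) * l + (k + 2) * (l + 1)
      + (square_inv ?b ?c + square_inv ?c ?b))"
    unfolding cell_weight_def 1 2 3 w zero by simp
  then show ?thesis unfolding swap by auto
qed

lemma cell_weight_commute: "even (cell_weight L M N R) \<longleftrightarrow> even (cell_weight L N M R)"
  by (simp add: cell_weight_def ac_simps)

text \<open>When \<open>M = N\<close> the sides coincide in pairs and the middle corner counts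
  twice, so only the weights of \<open>L\<close> and \<open>R\<close> survive modulo 2.\<close>

lemma even_cell_weight_doubled:
  assumes "finite R" "L \<subseteq> M" "M \<subseteq> R"
  shows "even (cell_weight L M M R) \<longleftrightarrow> even (diagram_weight (M - L) + diagram_weight (R - M))"
  using diagram_weight_step[OF finite_subset[OF assms(3,1)] assms(2)] diagram_weight_step[OF assms(1,3)]
  by (auto simp: cell_weight_def)

text \<open>The weight is \<open>(k + 1) * (2 * l + 1)\<close>; for the vertical domino below it is
  \<open>(2 * k + 3) * l\<close>.\<close>

lemma diagram_weight_horizontal:
  "even (diagram_weight {(k, l), (k, l + 1)}) \<longleftrightarrow> odd k"
  by (cases "even k"; cases "even l") (simp_all add: diagram_weight_def)

lemma diagram_weight_vertical:
  "even (diagram_weight {(k, l), (k + 1, l)}) \<longleftrightarrow> even l"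
  by (cases "even k"; cases "even l") (simp_all add: diagram_weight_def)

section \<open>The local rules and the parity of the cells they fill\<close>

lemma local_rule_letter:
  assumes L: "young L" and a: "\<bar>a\<bar> = int j" "j \<ge> 1"
  shows "young (local_rule a j L L L)" "domino_step L (local_rule a j L L L)"
    and "even (cell_weight L L L (local_rule a j L L L)) \<longleftrightarrow> a > 0"
proof -
  let ?R = "local_rule a j L L L"
  consider "a = int j" | "a = - int j" using a by linarith
  then have "young ?R \<and> domino_step L ?R \<and> (even (cell_weight L L L ?R) \<longleftrightarrow> a > 0)"
  proof cases
    case 1
    \<comment> \<open>Since \<open>L = M = N\<close>, the parity of the cell is that of the added
      domino, and a horizontal domino in row 1 has even weight.\<close>
    then have R: "?R = add_to_row 1 L" by (simp add: local_rule_def)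
    have y: "young ?R" and d: "?R - L = {(1, row_length L 1 + 1), (1, row_length L 1 + 1 + 1)}"
      unfolding R using young_add_to_row[OF L, of 1] by auto
    have sub: "L \<subseteq> ?R" by (auto simp: R add_to_row_def)
    have "domino_step L ?R" using sub d unfolding domino_step_def domino_def by blast
    then show ?thesis
      using y 1 a even_cell_weight_doubled[OF young_finite[OF y] subset_refl sub]
        diagram_weight_horizontal[of 1 "row_length L 1 + 1"]
      unfolding d by (simp add: diagram_weight_def)
  next
    case 2
    \<comment> \<open>A vertical domino in column 1 has odd weight, which is how the cell detects
      the sign.\<close>
    then have R: "?R = add_to_col 1 L" using a by (simp add: local_rule_def)
    have y: "young ?R" and d: "?R - L = {(col_length L 1 + 1, 1), (col_length L 1 + 1 + 1, 1)}"
      unfolding R using young_add_to_col[OF L, of 1] by auto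
    have sub: "L \<subseteq> ?R" by (auto simp: R add_to_col_def)
    have "domino_step L ?R" using sub d unfolding domino_step_def domino_def by blast
    then show ?thesis
      using y 2 a even_cell_weight_doubled[OF young_finite[OF y] subset_refl sub]
        diagram_weight_vertical[of "col_length L 1 + 1" 1]
      unfolding d by (simp add: diagram_weight_def)
  qed
  then show "young ?R" "domino_step L ?R" "even (cell_weight L L L ?R) \<longleftrightarrow> a > 0" by auto
qed

text \<open>The common square must be the top left square of each domino: a square of
  \<open>M - L\<close> weakly above and to the left of it lies in \<open>N\<close> as well, hence in
  the intersection.\<close>

lemma overlapping_domino:
  assumes "young M" "young N" "domino_step L M" "(M - L) \<inter> (N - L) = {(k, l)}"
  shows "M - L = {(k, l), (k, l + 1)} \<or> M - L = {(k, l), (k + 1, l)}"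
proof -
  have kl: "(k, l) \<in> M - L" "(k, l) \<in> N" using assms(4) by auto
  have least: "(i, j) = (k, l)" if "(i, j) \<in> M - L" "i \<le> k" "j \<le> l" for i j
  proof -
    have "(i, j) \<in> N"
      using youngD[OF assms(2) kl(2), of i j] young_pos[OF assms(1), of i j] that by auto
    then show ?thesis using that(1) assms(4) by blast
  qed
  obtain k' l' where d: "M - L = {(k', l'), (k', l' + 1)} \<or> M - L = {(k', l'), (k' + 1, l')}"
    using assms(3) unfolding domino_step_def domino_def by blast
  then have "(k', l') \<in> M - L \<and> k' \<le> k \<and> l' \<le> l"
  proof
    assume e: "M - L = {(k', l'), (k', l' + 1)}"
    show ?thesis using kl(1) unfolding e by auto
  next
    assume e: "M - L = {(k', l'), (k' + 1, l')}"
    show ?thesis using kl(1) unfolding e by auto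
  qed
  then have "(k', l') = (k, l)" using least by blast
  with d show ?thesis by simp
qed

lemma domino_rule_block:
  assumes L: "young L" and M: "young M" and N: "young N" and sub: "L \<subseteq> M" "L \<subseteq> N"
    and dM: "M - L = {(k, l), (k, l + 1)}" and dN: "N - L = {(k, l), (k + 1, l)}"
  defines "R \<equiv> M \<union> N \<union> {(k + 1, l + 1)}"
  shows "young R" "domino_step M R" "domino_step N R" "odd (cell_weight L M N R)"
proof -
  have pos: "1 \<le> k" "1 \<le> l" using young_pos[OF M, of k l] dM by auto
  have kl: "(k, l) \<notin> L" using dM by auto
  then have notL: "(k, l + 1) \<notin> L" "(k + 1, l) \<notin> L" "(k + 1, l + 1) \<notin> L"
    using youngD[OF L _ pos(1) _ pos(2)] by force+
  have M_eq: "M = L \<union> {(k, l), (k, l + 1)}" and N_eq: "N = L \<union> {(k, l), (k + 1, l)}"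
    using sub dM dN by blast+
  have R_eq: "R = L \<union> {(k, l), (k, l + 1), (k + 1, l), (k + 1, l + 1)}"
    unfolding R_def M_eq N_eq by blast
  have "young (insert (k + 1, l + 1) (M \<union> N))"
    by (intro young_add_corner young_Un M N) (auto simp: M_eq N_eq)
  then show "young R" by (simp add: R_def)
  have "R - M = {(k + 1, l), (k + 1, l + 1)}"
    using notL unfolding R_eq M_eq by auto
  then show "domino_step M R" unfolding domino_step_def domino_def by (auto simp: R_def)
  have "R - N = {(k, l + 1), (k + 1, l + 1)}"
    using notL unfolding R_eq N_eq by auto
  then show "domino_step N R" unfolding domino_step_def domino_def by (auto simp: R_def)
  show "odd (cell_weight L M N R)"
    using cell_weight_block[OF young_finite[OF L] kl notL M_eq N_eq R_eq] .
qed

text \<open>The cases are the possible sizes 0, 1, 2 of the intersection of the two dominos.\<close>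

lemma domino_rule_step:
  assumes L: "young L" and M: "young M" and N: "young N"
    and LM: "domino_step L M" and LN: "domino_step L N"
  defines "R \<equiv> domino_rule L M N"
  shows "young R \<and> domino_step M R \<and> domino_step N R \<and> odd (cell_weight L M N R)"
proof -
  have sub: "L \<subseteq> M" "L \<subseteq> N" using LM LN by (auto simp: domino_step_def)
  consider (disjoint) "(M - L) \<inter> (N - L) = {}"
    | (overlap) k l where "(M - L) \<inter> (N - L) = {(k, l)}"
    | (equal) "M = N" "\<not> is_singleton (M - L)"
  proof -
    have "card (M - L) = 2" "card (N - L) = 2"
      using LM LN by (auto simp: domino_step_def domino_def)
    then have fin: "finite (M - L)" "finite (N - L)" and c: "card (M - L) = 2" "card (N - L) = 2"
      by (auto intro: card_ge_0_finite)
    have "card ((M - L) \<inter> (N - L)) \<le> 2"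
      using card_mono[OF fin(1), of "(M - L) \<inter> (N - L)"] c by simp
    then consider "card ((M - L) \<inter> (N - L)) = 0" | "card ((M - L) \<inter> (N - L)) = 1"
      | "card ((M - L) \<inter> (N - L)) = 2" by linarith
    then show ?thesis
    proof cases
      case 1
      then show ?thesis using disjoint fin by auto
    next
      case 2
      then show ?thesis using overlap by (metis card_1_singletonE surj_pair)
    next
      case 3
      then have "(M - L) \<inter> (N - L) = M - L" "(M - L) \<inter> (N - L) = N - L"
        using fin c by (intro card_subset_eq; simp)+
      then have "M = N" using sub by blast
      then show ?thesis using equal c by (simp add: is_singleton_altdef)
    qed
  qed
  then show ?thesis
  proof cases
    case disjoint
    then have R: "R = M \<union> N" using sub by (auto simp: R_def domino_rule_def Let_def)
    have "R - M = N - L" "R - N = M - L" using R sub disjoint by blast+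
    then show ?thesis
      using LM LN young_Un[OF M N] cell_weight_disjoint[OF young_finite[OF M] young_finite[OF N] LM LN disjoint]
      by (auto simp: domino_step_def R)
  next
    case (overlap k l)
    have "R = L \<union> (M - L) \<union> (N - L) \<union> {(k + 1, l + 1)}"
      unfolding R_def domino_rule_def Let_def overlap by (simp add: is_singleton_def)
    then have R: "R = M \<union> N \<union> {(k + 1, l + 1)}" "R = N \<union> M \<union> {(k + 1, l + 1)}" using sub by blast+
    have "M - L \<noteq> N - L"
    proof
      assume "M - L = N - L"
      with overlap have "M - L = {(k, l)}" by simp
      with LM show False by (auto simp: domino_step_def domino_def doubleton_eq_iff)
    qed
    \<comment> \<open>Both dominos start at \<open>(k, l)\<close> and they differ, so one is
      horizontal and the other vertical. The second case is the first with \<open>M\<close> and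
      \<open>N\<close> exchanged.\<close>
    then consider "M - L = {(k, l), (k, l + 1)}" "N - L = {(k, l), (k + 1, l)}"
      | "N - L = {(k, l), (k, l + 1)}" "M - L = {(k, l), (k + 1, l)}"
      using overlapping_domino[OF M N LM overlap]
        overlapping_domino[OF N M LN overlap[unfolded Int_commute[of "M - L"]]] by metis
    then show ?thesis
    proof cases
      case 1
      then show ?thesis using domino_rule_block[OF L M N sub 1] unfolding R(1) by blast
    next
      case 2
      then show ?thesis using domino_rule_block[OF L N M sub(2,1) 2] cell_weight_commute
        unfolding R(2) by blast
    qed
  next
    case equal
    have "M - L \<noteq> {}" using LM by (auto simp: domino_step_def domino_def)
    then have R': "R = (if is_singleton (fst ` (M - L)) then add_to_row (the_elem (fst ` (M - L)) + 1) M
        else add_to_col (the_elem (snd ` (M - L)) + 1) M)"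
      unfolding R_def domino_rule_def Let_def equal(1)[symmetric] Int_absorb using equal(2) by simp
    obtain k l where "M - L = {(k, l), (k, l + 1)} \<or> M - L = {(k, l), (k + 1, l)}"
      using LM unfolding domino_step_def domino_def by blast
    then show ?thesis
    proof
      assume d: "M - L = {(k, l), (k, l + 1)}"
      have R: "R = add_to_row (k + 1) M"
        by (simp add: R' d)
      have pos: "1 \<le> k" "1 \<le> l" using young_pos[OF M, of k l] d by auto
      \<comment> \<open>If \<open>(k + 1, l)\<close> were in \<open>M\<close>, it would be in
        \<open>L\<close>, and then so would \<open>(k, l)\<close>. Hence row \<open>k + 1\<close>
        ends before column \<open>l\<close> while row \<open>k\<close> reaches \<open>l + 1\<close>,
        leaving room for a domino.\<close>
      have "(k, l) \<in> M - L" "(k + 1, l) \<notin> M - L" unfolding d by auto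
      then have "(k + 1, l) \<notin> M"
        using youngD[OF L, of "k + 1" l k l] pos by auto
      then have "row_length M (k + 1) < l"
        using young_row[OF M, of "k + 1" l] pos by auto
      moreover have "l + 1 \<le> row_length M k"
        using young_row[OF M, of k "l + 1"] pos d by auto
      ultimately have le: "row_length M (k + 1) + 2 \<le> row_length M (k + 1 - 1)" by simp
      have y: "young R" and dR: "R - M = {(k + 1, row_length M (k + 1) + 1), (k + 1, row_length M (k + 1) + 1 + 1)}"
        using young_add_to_row[OF M, of "k + 1"] le by (simp_all add: R)
      have MR: "M \<subseteq> R" by (auto simp: R add_to_row_def)
      then have "domino_step M R" using dR unfolding domino_step_def domino_def by blast
      \<comment> \<open>The dominos lie in the consecutive rows \<open>k\<close> and
        \<open>k + 1\<close>, so their weights have opposite parities.\<close>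
      moreover have "odd (cell_weight L M M R)"
        unfolding even_cell_weight_doubled[OF young_finite[OF y] sub(1) MR] even_add d dR
          diagram_weight_horizontal by simp
      ultimately show ?thesis using y equal(1) by auto
    next
      assume d: "M - L = {(k, l), (k + 1, l)}"
      have R: "R = add_to_col (l + 1) M"
        by (simp add: R' d is_singleton_def doubleton_eq_iff)
      have pos: "1 \<le> k" "1 \<le> l" using young_pos[OF M, of k l] d by auto
      \<comment> \<open>The transposed argument, with columns \<open>l\<close> and
        \<open>l + 1\<close>.\<close>
      have "(k, l) \<in> M - L" "(k, l + 1) \<notin> M - L" unfolding d by auto
      then have "(k, l + 1) \<notin> M"
        using youngD[OF L, of k "l + 1" k l] pos by auto
      then have "col_length M (l + 1) < k"
        using young_col[OF M, of "l + 1" k] pos by auto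
      moreover have "k + 1 \<le> col_length M l"
        using young_col[OF M, of l "k + 1"] pos d by auto
      ultimately have le: "col_length M (l + 1) + 2 \<le> col_length M (l + 1 - 1)" by simp
      have y: "young R" and dR: "R - M = {(col_length M (l + 1) + 1, l + 1), (col_length M (l + 1) + 1 + 1, l + 1)}"
        using young_add_to_col[OF M, of "l + 1"] le by (simp_all add: R)
      have MR: "M \<subseteq> R" by (auto simp: R add_to_col_def)
      then have "domino_step M R" using dR unfolding domino_step_def domino_def by blast
      moreover have "odd (cell_weight L M M R)"
        unfolding even_cell_weight_doubled[OF young_finite[OF y] sub(1) MR] even_add d dR
          diagram_weight_vertical by simp
      ultimately show ?thesis using y equal(1) by auto
    qed
  qed
qed

text \<open>This excludes the branches \<open>L = M\<close> and \<open>L = N\<close> of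
  \<open>local_rule\<close> when both steps are dominos.\<close>

lemma not_domino_step_refl: "\<not> domino_step L L"
  by (simp add: domino_step_def domino_def)

text \<open>The flag records whether the step is nontrivial. In the growth diagram it becomes an
  explicit condition on the letters.\<close>

definition growth_step :: "bool \<Rightarrow> diagram \<Rightarrow> diagram \<Rightarrow> bool" where
  "growth_step c L M \<longleftrightarrow> (if c then domino_step L M else L = M)"

text \<open>Away from the letters, opposite sides have the same flag. If one flag is false, the
  corners and the sides of the cell coincide in pairs, so its weight is even.\<close>

lemma local_rule_step:
  assumes "young L" "young M" "young N" "growth_step c L M" "growth_step d L N"
    and "\<bar>a\<bar> \<noteq> int j"
  defines "R \<equiv> local_rule a j L M N"
  shows "young R \<and> growth_step c N R \<and> growth_step d M R \<and> (odd (cell_weight L M N R) \<longleftrightarrow> c \<and> d)"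
proof -
  have a: "a \<noteq> int j" "a \<noteq> - int j" using assms(6) by auto
  have R: "R = (if L = M then N else if L = N then M else domino_rule L M N)"
    using a by (simp add: R_def local_rule_def)
  show ?thesis
  proof (cases "c \<and> d")
    case True
    then have "domino_step L M" "domino_step L N" using assms(4,5) by (auto simp: growth_step_def)
    then show ?thesis
      using True domino_rule_step[OF assms(1-3)] R not_domino_step_refl by (auto simp: growth_step_def)
  next
    case False
    then consider "\<not> c" "L = M" | "\<not> d" "L = N" using assms(4,5) by (auto simp: growth_step_def)
    then show ?thesis
    proof cases
      case 1
      then have "R = N" by (simp add: R)
      then show ?thesis using 1 assms(2-5) by (auto simp: growth_step_def cell_weight_def)
    next
      case 2
      then have "R = M" by (simp add: R)
      then show ?thesis using 2 assms(2-5) by (auto simp: growth_step_def cell_weight_def)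
    qed
  qed
qed


section \<open>Summation over the growth diagram\<close>

lemma growth_border: "growth r w i 0 = staircase r" "growth r w 0 j = staircase r"
  by (cases i; simp)+

context
  fixes n r :: nat and w :: "int \<Rightarrow> int"
  assumes w: "w \<in> hyperoctahedral n"
begin

abbreviation (input) "g \<equiv> growth r w"

text \<open>With \<open>i\<close> and \<open>j\<close> counted from 0, the cell belongs to position
  \<open>i + 1\<close> and absolute value \<open>j + 1\<close>. The step in direction
  \<open>j\<close> is a domino iff that value occurs among the first \<open>i\<close> letters, the
  step in direction \<open>i\<close> iff the letter has absolute value at most \<open>j\<close>.
  Both hold exactly at an inversion.\<close>

lemma growth_cell:
  assumes "young (g i j)" "young (g i (Suc j))" "young (g (Suc i) j)"
    and c: "growth_step (\<exists>a\<in>{1..i}. \<bar>w (int a)\<bar> = int (Suc j)) (g i j) (g i (Suc j))"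
    and d: "growth_step (\<bar>w (int (Suc i))\<bar> \<le> int j) (g i j) (g (Suc i) j)"
  shows "young (g (Suc i) (Suc j))
    \<and> growth_step (\<exists>a\<in>{1..Suc i}. \<bar>w (int a)\<bar> = int (Suc j)) (g (Suc i) j) (g (Suc i) (Suc j))
    \<and> growth_step (\<bar>w (int (Suc i))\<bar> \<le> int (Suc j)) (g i (Suc j)) (g (Suc i) (Suc j))
    \<and> (odd (cell_weight (g i j) (g i (Suc j)) (g (Suc i) j) (g (Suc i) (Suc j))) \<longleftrightarrow>
        w (int (Suc i)) = - int (Suc j)
        \<or> (\<exists>a\<in>{1..i}. \<bar>w (int a)\<bar> = int (Suc j)) \<and> \<bar>w (int (Suc i))\<bar> \<le> int j)"
proof (cases "\<bar>w (int (Suc i))\<bar> = int (Suc j)")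
  case True
  \<comment> \<open>At a letter both incoming steps are trivial, because no earlier letter has the
    same absolute value.\<close>
  have no: "\<not> (\<exists>a\<in>{1..i}. \<bar>w (int a)\<bar> = int (Suc j))"
  proof
    assume "\<exists>a\<in>{1..i}. \<bar>w (int a)\<bar> = int (Suc j)"
    then obtain a where "a \<in> {1..i}" "\<bar>w (int a)\<bar> = \<bar>w (int (Suc i))\<bar>" using True by auto
    then show False using hyperoctahedral_abs_inj[OF w, of a "Suc i"] by auto
  qed
  have eq: "g i (Suc j) = g i j" "g (Suc i) j = g i j"
    using c d no True by (simp_all add: growth_step_def)
  have R: "g (Suc i) (Suc j) = local_rule (w (int (Suc i))) (Suc j) (g i j) (g i j) (g i j)"
    unfolding growth.simps eq ..
  have ex: "\<exists>a\<in>{1..Suc i}. \<bar>w (int a)\<bar> = int (Suc j)"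
    using True by (intro bexI[of _ "Suc i"]) auto
  have sgn: "w (int (Suc i)) > 0 \<longleftrightarrow> w (int (Suc i)) \<noteq> - int (Suc j)" using True by linarith
  note * = local_rule_letter[OF assms(1) True le_add1[of 1 j, unfolded plus_1_eq_Suc]]
  show ?thesis
    unfolding eq R using * ex no sgn True by (simp add: growth_step_def del: of_nat_Suc atLeastAtMost_iff)
next
  case False
  have ex: "(\<exists>a\<in>{1..Suc i}. \<bar>w (int a)\<bar> = int (Suc j)) \<longleftrightarrow> (\<exists>a\<in>{1..i}. \<bar>w (int a)\<bar> = int (Suc j))"
    using False by (auto simp: le_Suc_eq simp del: of_nat_Suc)
  have le: "\<bar>w (int (Suc i))\<bar> \<le> int (Suc j) \<longleftrightarrow> \<bar>w (int (Suc i))\<bar> \<le> int j"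
    using False by linarith
  have ne: "w (int (Suc i)) \<noteq> - int (Suc j)" using False by linarith
  show ?thesis
    unfolding ex le growth.simps(3)[of r w i j]
    using local_rule_step[OF assms False] ne by simp
qed

text \<open>The inner half of a double induction: \<open>i\<close> is fixed and \<open>j\<close>
  grows. The bound \<open>i < n\<close> makes the letter nonzero, so the step on the border
  \<open>j = 0\<close> is trivial as required.\<close>

lemma growth_next_column:
  assumes "i < n"
    and "\<And>j. young (g i j) \<and> growth_step (\<exists>a\<in>{1..i}. \<bar>w (int a)\<bar> = int (Suc j)) (g i j) (g i (Suc j))"
  shows "young (g (Suc i) j) \<and> growth_step (\<bar>w (int (Suc i))\<bar> \<le> int j) (g i j) (g (Suc i) j)"
proof (induction j)
  case 0
  have "\<bar>w (int (Suc i))\<bar> > 0"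
    using hyperoctahedral_range[OF w, of "Suc i"] assms(1) by auto
  then show ?case by (simp add: growth_border young_staircase growth_step_def)
next
  case (Suc j)
  then show ?case using growth_cell[of i j] assms(2) by blast
qed

lemma growth_row_steps:
  assumes "i \<le> n"
  shows "young (g i j) \<and> growth_step (\<exists>a\<in>{1..i}. \<bar>w (int a)\<bar> = int (Suc j)) (g i j) (g i (Suc j))"
  using assms
proof (induction i arbitrary: j)
  case 0
  then show ?case by (simp add: growth_border young_staircase growth_step_def)
next
  case (Suc i)
  then have IH: "young (g i j) \<and> growth_step (\<exists>a\<in>{1..i}. \<bar>w (int a)\<bar> = int (Suc j)) (g i j) (g i (Suc j))" for j
    by simp
  then show ?case
    using growth_next_column[OF _ IH] growth_cell[of i j] Suc.prems by (meson Suc_le_eq)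
qed

lemma odd_growth_cell_weight:
  assumes "i < n"
  shows "odd (cell_weight (g i j) (g i (Suc j)) (g (Suc i) j) (g (Suc i) (Suc j))) \<longleftrightarrow>
    w (int (Suc i)) = - int (Suc j)
    \<or> (\<exists>a\<in>{1..i}. \<bar>w (int a)\<bar> = int (Suc j)) \<and> \<bar>w (int (Suc i))\<bar> \<le> int j"
proof -
  have row: "young (g i j) \<and> growth_step (\<exists>a\<in>{1..i}. \<bar>w (int a)\<bar> = int (Suc j)) (g i j) (g i (Suc j))" for j
    using assms by (intro growth_row_steps) simp
  show ?thesis
    using growth_cell[of i j] row growth_next_column[OF assms row] by blast
qed

section \<open>The odd cells and the telescoping of their weights\<close>

definition odd_cells :: "(nat \<times> nat) set" where
  "odd_cells = {(i, j). i < n \<and> j < n \<and>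
     odd (cell_weight (g i j) (g i (Suc j)) (g (Suc i) j) (g (Suc i) (Suc j)))}"

lemma card_odd_cells: "card odd_cells = parity_count n w"
proof -
  define N where "N = (\<lambda>a. (a - 1, nat \<bar>w (int a)\<bar> - 1)) ` neg_positions n w"
  \<comment> \<open>The cell of an inversion is in the row of the later position and the column of
    the larger absolute value. This determines both positions. The shift by 1 is there because cells
    are indexed from 0.\<close>
  define I where "I = (\<lambda>(a, b). (b - 1, nat \<bar>w (int a)\<bar> - 1)) ` abs_inversions n w"
  have rng: "1 \<le> \<bar>w (int a)\<bar> \<and> \<bar>w (int a)\<bar> \<le> int n" if "1 \<le> a" "a \<le> n" for a
    using hyperoctahedral_range[OF w, of a] that by auto
  have memN: "(i, j) \<in> N \<longleftrightarrow> i < n \<and> j < n \<and> w (int (Suc i)) = - int (Suc j)" for i j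
  proof
    assume "(i, j) \<in> N"
    then obtain a where a: "1 \<le> a" "a \<le> n" "w (int a) < 0" "i = a - 1" "j = nat \<bar>w (int a)\<bar> - 1"
      by (auto simp: N_def neg_positions_def)
    then have "a = Suc i" by simp
    moreover have "w (int a) = - int (Suc j)" "j < n" "a - 1 < n" using a rng[of a] by arith+
    ultimately show "i < n \<and> j < n \<and> w (int (Suc i)) = - int (Suc j)" by simp
  next
    assume *: "i < n \<and> j < n \<and> w (int (Suc i)) = - int (Suc j)"
    then have "Suc i \<in> neg_positions n w" by (simp add: neg_positions_def)
    moreover have "(i, j) = (Suc i - 1, nat \<bar>w (int (Suc i))\<bar> - 1)" using * by simp
    ultimately show "(i, j) \<in> N" unfolding N_def by blast
  qed
  have memI: "(i, j) \<in> I \<longleftrightarrow> i < n \<and> j < n \<and>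
      (\<exists>a\<in>{1..i}. \<bar>w (int a)\<bar> = int (Suc j)) \<and> \<bar>w (int (Suc i))\<bar> \<le> int j" for i j
  proof
    assume "(i, j) \<in> I"
    then obtain a b where a: "1 \<le> a" "a \<le> n" and b: "b \<le> n" "a < b" "\<bar>w (int b)\<bar> < \<bar>w (int a)\<bar>"
      and ij: "i = b - 1" "j = nat \<bar>w (int a)\<bar> - 1"
      by (auto simp: I_def abs_inversions_def)
    then have "b = Suc i" "a \<in> {1..i}" by auto
    moreover have "\<bar>w (int a)\<bar> = int (Suc j)" "j < n" using ij rng[OF a] by arith+
    ultimately show "i < n \<and> j < n \<and>
      (\<exists>a\<in>{1..i}. \<bar>w (int a)\<bar> = int (Suc j)) \<and> \<bar>w (int (Suc i))\<bar> \<le> int j"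
      using b by (auto simp del: of_nat_Suc)
  next
    assume *: "i < n \<and> j < n \<and>
      (\<exists>a\<in>{1..i}. \<bar>w (int a)\<bar> = int (Suc j)) \<and> \<bar>w (int (Suc i))\<bar> \<le> int j"
    then obtain a where a: "a \<in> {1..i}" "\<bar>w (int a)\<bar> = int (Suc j)" by blast
    then have "(a, Suc i) \<in> abs_inversions n w" using * by (auto simp: abs_inversions_def)
    moreover have "(i, j) = (\<lambda>(a, b). (b - 1, nat \<bar>w (int a)\<bar> - 1)) (a, Suc i)" using a by simp
    ultimately show "(i, j) \<in> I" unfolding I_def by (metis imageI)
  qed
  have "(i, j) \<in> odd_cells \<longleftrightarrow> (i, j) \<in> N \<union> I" for i j
    unfolding odd_cells_def mem_Collect_eq prod.case Un_iff memN memI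
    using odd_growth_cell_weight[of i j] by blast
  then have "odd_cells = N \<union> I" by auto
  \<comment> \<open>In \<open>N\<close> the letter has absolute value \<open>j + 1\<close>, in
    \<open>I\<close> at most \<open>j\<close>.\<close>
  moreover have "N \<inter> I = {}"
    by (auto simp: memN memI)
  moreover have "finite N" "finite I"
    by (simp_all add: N_def I_def finite_neg_positions finite_abs_inversions)
  moreover have "card N = card (neg_positions n w)"
    unfolding N_def by (intro card_image inj_onI) (auto simp: neg_positions_def)
  moreover have "card I = card (abs_inversions n w)"
    unfolding I_def
  proof (intro card_image inj_onI, clarify)
    fix a b a' b'
    assume "(a, b) \<in> abs_inversions n w" "(a', b') \<in> abs_inversions n w"
      and eq: "b - 1 = b' - 1" "nat \<bar>w (int a)\<bar> - 1 = nat \<bar>w (int a')\<bar> - 1"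
    then have "1 \<le> a" "a \<le> n" "1 \<le> a'" "a' \<le> n" "1 \<le> b" "1 \<le> b'"
      by (auto simp: abs_inversions_def)
    with eq have "nat \<bar>w (int a)\<bar> - 1 = nat \<bar>w (int a')\<bar> - 1" "1 \<le> \<bar>w (int a)\<bar>" "1 \<le> \<bar>w (int a')\<bar>" "b = b'"
      using rng[of a] rng[of a'] by auto
    then have "\<bar>w (int a)\<bar> = \<bar>w (int a')\<bar>" "b = b'" by arith+
    then show "a = a' \<and> b = b'" using hyperoctahedral_abs_inj[OF w] by blast
  qed
  ultimately show ?thesis by (simp add: card_Un_disjoint parity_count_def)
qed

end

text \<open>The corner weights are all attached to the steps in direction \<open>j\<close>, so that
  each cell counts every corner once; hence \<open>Q_weight\<close> has no such terms.
  \<open>length T - 1\<close> is the number of steps.\<close>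

definition P_weight :: "tableau \<Rightarrow> nat" where
  "P_weight T = (\<Sum>j<length T - 1. step_inv (T ! j) (T ! Suc j) + diagram_weight (T ! j) + diagram_weight (T ! Suc j))"

definition Q_weight :: "tableau \<Rightarrow> nat" where
  "Q_weight T = (\<Sum>i<length T - 1. step_inv (T ! i) (T ! Suc i))"

lemma even_telescope: "even ((\<Sum>i<m. f i + f (Suc i)) + f 0 + f m)" for f :: "nat \<Rightarrow> nat"
  by (induction m) auto

lemma even_parity_count_iff:
  assumes w: "w \<in> hyperoctahedral n"
  shows "even (parity_count n w) \<longleftrightarrow> even (P_weight (P_tableau r n w) + Q_weight (Q_tableau r n w))"
proof -
  let ?g = "growth r w"
  define p where "p i j = step_inv (?g i j) (?g i (Suc j)) + diagram_weight (?g i j) + diagram_weight (?g i (Suc j))" for i j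
  define q where "q i j = step_inv (?g i j) (?g (Suc i) j)" for i j
  let ?c = "\<lambda>i j. cell_weight (?g i j) (?g i (Suc j)) (?g (Suc i) j) (?g (Suc i) (Suc j))"
  have c: "?c i j = (p i j + p (Suc i) j) + (q i j + q i (Suc j))" for i j
    by (simp add: cell_weight_def p_def q_def)
  have fin: "finite (odd_cells n r w)"
    by (rule finite_subset[of _ "{..<n} \<times> {..<n}"]) (auto simp: odd_cells_def[OF w])
  \<comment> \<open>The number of odd terms of a sum has the parity of the sum.\<close>
  have "even (card (odd_cells n r w)) \<longleftrightarrow> even (\<Sum>(i, j)\<in>{..<n} \<times> {..<n}. ?c i j)"
  proof -
    have "{x \<in> {..<n} \<times> {..<n}. odd (case x of (i, j) \<Rightarrow> ?c i j)} = odd_cells n r w"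
      by (auto simp: odd_cells_def[OF w])
    then show ?thesis
      using even_sum_iff[of "{..<n} \<times> {..<n}" "\<lambda>(i, j). ?c i j"] by simp
  qed
  also have "(\<Sum>(i, j)\<in>{..<n} \<times> {..<n}. ?c i j) = (\<Sum>i<n. \<Sum>j<n. ?c i j)"
    by (simp add: sum.cartesian_product)
  \<comment> \<open>The sums are arranged so that \<open>p\<close> telescopes in \<open>i\<close>
    and \<open>q\<close> telescopes in \<open>j\<close>, leaving only border terms modulo 2.\<close>
  also have "\<dots> = (\<Sum>j<n. \<Sum>i<n. p i j + p (Suc i) j) + (\<Sum>i<n. \<Sum>j<n. q i j + q i (Suc j))"
  proof -
    have "(\<Sum>i<n. \<Sum>j<n. p i j + p (Suc i) j) = (\<Sum>j<n. \<Sum>i<n. p i j + p (Suc i) j)"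
      by (rule sum.swap)
    then show ?thesis
      unfolding c by (simp only: sum.distrib[of "\<lambda>j. p i j + p (Suc i) j" "\<lambda>j. q i j + q i (Suc j)" for i]
        sum.distrib[of "\<lambda>i. \<Sum>j<n. p i j + p (Suc i) j"])
  qed
  finally have "even (card (odd_cells n r w)) \<longleftrightarrow>
    even ((\<Sum>j<n. \<Sum>i<n. p i j + p (Suc i) j) + (\<Sum>i<n. \<Sum>j<n. q i j + q i (Suc j)))" .
  moreover have "even ((\<Sum>j<n. (\<Sum>i<n. p i j + p (Suc i) j) + p 0 j + p n j))"
    by (intro dvd_sum even_telescope)
  moreover have "even ((\<Sum>i<n. (\<Sum>j<n. q i j + q i (Suc j)) + q i 0 + q i n))"
    by (intro dvd_sum even_telescope)
  \<comment> \<open>On this border both ends of a step are the staircase, whose weight is counted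
    twice.\<close>
  moreover have "even (\<Sum>j<n. p 0 j)"
    by (intro dvd_sum) (simp add: p_def growth_border)
  moreover have "(\<Sum>i<n. q i 0) = 0"
    by (simp add: q_def growth_border)
  moreover have "P_weight (P_tableau r n w) = (\<Sum>j<n. p n j)"
    by (simp add: P_weight_def P_tableau_def p_def del: upt_Suc)
  moreover have "Q_weight (Q_tableau r n w) = (\<Sum>i<n. q i n)"
    by (simp add: Q_weight_def Q_tableau_def q_def del: upt_Suc)
  ultimately show ?thesis
    unfolding card_odd_cells[OF w] sum.distrib[of _ "\<lambda>j. p n j"] sum.distrib[of _ "\<lambda>i. q i n"]
      sum.distrib[of _ "\<lambda>j. p 0 j"] sum.distrib[of _ "\<lambda>i. q i 0"]
    by simp
qed

theorem mainTheorem2: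
  fixes n r :: nat and x x' y y' :: "int \<Rightarrow> int"
  assumes "n \<ge> 1"
    and "x \<in> hyperoctahedral n" "x' \<in> hyperoctahedral n"
    and "y \<in> hyperoctahedral n" "y' \<in> hyperoctahedral n"
    and "fst (domino_RS r n x) = fst (domino_RS r n y)"
    and "fst (domino_RS r n x') = fst (domino_RS r n y')"
    and "snd (domino_RS r n x) = snd (domino_RS r n x')"
    and "snd (domino_RS r n y) = snd (domino_RS r n y')"
  shows "mu_sign n x y = mu_sign n x' y'"
proof -
  have len: "even (len n w) \<longleftrightarrow> even (P_weight (P_tableau r n w) + Q_weight (Q_tableau r n w))"
    if "w \<in> hyperoctahedral n" for w
    using even_len_iff[OF assms(1) that] even_parity_count_iff[OF that] by simp
  \<comment> \<open>The equal \<open>P\<close> parts cancel modulo 2 on each side, and what remains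
    are the \<open>Q\<close> parts of \<open>x\<close>, \<open>y\<close> and of \<open>x'\<close>,
    \<open>y'\<close>, which agree.\<close>
  have "even (len n x + len n y) \<longleftrightarrow> even (len n x' + len n y')"
    using len[OF assms(2)] len[OF assms(3)] len[OF assms(4)] len[OF assms(5)] assms(6-9)
    by (auto simp: domino_RS_def)
  then show ?thesis
    by (cases "even (len n x + len n y)") (simp_all add: mu_sign_def)
qed

end
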